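(* Let $\mathbf{K}$ be a finite set of finite subdirectly irreducible Heyting algebras with involution, and let $\mathbf{V}=V(\mathbf{K})$ be the variety generated by $\mathbf{K}$. Then $\mathbf{V}$ is a discriminator variety.
   Context: A Heyting algebra with involution is an algebra $\langle A,\lor,\land,\to,\neg,\sim,0,1\rangle$ where $\langle A,\lor,\land,\to,\neg,0,1\rangle$ is a Heyting algebra ($a\to b=\sup\{x:a\land x\le b\}$, $\neg a=a\to 0$) and $\sim$ satisfies $\sim(a\lor b)=\sim a\land\sim b$ and $\sim\sim a=a$. An algebra is subdirectly irreducible if whenever an intersection of a family of its congruences equals the identity relation, one of the congruences is the identity relation. A ternary term $t(x,y,z)$ is a discriminator for an algebra $\mathbf{A}$ if $t^{\mathbf{A}}(a,b,c)=a$ when $a\ne b$ and $t^{\mathbf{A}}(a,b,c)=c$ when $a=b$. A variety $\mathbf{V}$ is a discriminator variety if $\mathbf{V}$ is generated by some class $\mathbf{K}'\subseteq\mathbf{V}$ for which there is a single ternary term that is a discriminator for every algebra in $\mathbf{K}'$. *)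

theory Defs
  imports "HOL-Algebra.Congruence"
begin

record 'u hai = "'u partial_object" +
  join :: "'u \<Rightarrow> 'u \<Rightarrow> 'u" (infixl "\<squnion>\<index>" 65)
  meet :: "'u \<Rightarrow> 'u \<Rightarrow> 'u" (infixl "\<sqinter>\<index>" 70)
  imp :: "'u \<Rightarrow> 'u \<Rightarrow> 'u" (infixr "\<leadsto>\<index>" 60)
  pcompl :: "'u \<Rightarrow> 'u" ("neg\<index> _" [81] 80)
  invol :: "'u \<Rightarrow> 'u" ("\<sim>\<index> _" [81] 80)
  zero :: 'u ("\<zero>\<index>")
  one :: 'u ("\<one>\<index>")

text \<open>
  Algebras of the signature, with a nonempty carrier inside the type \<open>'u\<close>. This type plays the
  role of a universe: a class of algebras is a set of type \<open>'u hai set\<close>. No class of cardinals is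
  lost, since \<open>'u\<close> is arbitrary; and as soon as \<open>'u\<close> is infinite, every variety has its countably
  generated free algebras (up to isomorphism) in the universe, so it is determined by its members
  there.
\<close>

definition algebra :: "'u hai \<Rightarrow> bool" where
  "algebra A \<longleftrightarrow>
     carrier A \<noteq> {} \<and>
     (\<forall>a\<in>carrier A. \<forall>b\<in>carrier A.
        a \<squnion>\<^bsub>A\<^esub> b \<in> carrier A \<and> a \<sqinter>\<^bsub>A\<^esub> b \<in> carrier A \<and> a \<leadsto>\<^bsub>A\<^esub> b \<in> carrier A) \<and>
     (\<forall>a\<in>carrier A. neg\<^bsub>A\<^esub> a \<in> carrier A \<and> \<sim>\<^bsub>A\<^esub> a \<in> carrier A) \<and>
     \<zero>\<^bsub>A\<^esub> \<in> carrier A \<and> \<one>\<^bsub>A\<^esub> \<in> carrier A"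

definition below :: "'u hai \<Rightarrow> 'u \<Rightarrow> 'u \<Rightarrow> bool" where
  "below A a b \<longleftrightarrow> a \<sqinter>\<^bsub>A\<^esub> b = a"

definition bounded_lattice_alg :: "'u hai \<Rightarrow> bool" where
  "bounded_lattice_alg A \<longleftrightarrow>
     algebra A \<and>
     (\<forall>a\<in>carrier A. \<forall>b\<in>carrier A.
        a \<squnion>\<^bsub>A\<^esub> b = b \<squnion>\<^bsub>A\<^esub> a \<and> a \<sqinter>\<^bsub>A\<^esub> b = b \<sqinter>\<^bsub>A\<^esub> a \<and>
        a \<squnion>\<^bsub>A\<^esub> (a \<sqinter>\<^bsub>A\<^esub> b) = a \<and> a \<sqinter>\<^bsub>A\<^esub> (a \<squnion>\<^bsub>A\<^esub> b) = a) \<and>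
     (\<forall>a\<in>carrier A. \<forall>b\<in>carrier A. \<forall>c\<in>carrier A.
        (a \<squnion>\<^bsub>A\<^esub> b) \<squnion>\<^bsub>A\<^esub> c = a \<squnion>\<^bsub>A\<^esub> (b \<squnion>\<^bsub>A\<^esub> c) \<and>
        (a \<sqinter>\<^bsub>A\<^esub> b) \<sqinter>\<^bsub>A\<^esub> c = a \<sqinter>\<^bsub>A\<^esub> (b \<sqinter>\<^bsub>A\<^esub> c)) \<and>
     (\<forall>a\<in>carrier A. below A \<zero>\<^bsub>A\<^esub> a \<and> below A a \<one>\<^bsub>A\<^esub>)"

text \<open>
  In a Heyting algebra the supremum defining the implication is attained: it is the greatest
  element of the set. (Distributivity follows.)
\<close>

definition heyting_algebra :: "'u hai \<Rightarrow> bool" where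
  "heyting_algebra A \<longleftrightarrow>
     bounded_lattice_alg A \<and>
     (\<forall>a\<in>carrier A. \<forall>b\<in>carrier A.
        a \<leadsto>\<^bsub>A\<^esub> b \<in> {x \<in> carrier A. below A (a \<sqinter>\<^bsub>A\<^esub> x) b} \<and>
        (\<forall>y \<in> {x \<in> carrier A. below A (a \<sqinter>\<^bsub>A\<^esub> x) b}. below A y (a \<leadsto>\<^bsub>A\<^esub> b))) \<and>
     (\<forall>a\<in>carrier A. neg\<^bsub>A\<^esub> a = a \<leadsto>\<^bsub>A\<^esub> \<zero>\<^bsub>A\<^esub>)"

definition heyting_involution :: "'u hai \<Rightarrow> bool" where
  "heyting_involution A \<longleftrightarrow>
     heyting_algebra A \<and>
     (\<forall>a\<in>carrier A. \<forall>b\<in>carrier A. \<sim>\<^bsub>A\<^esub> (a \<squnion>\<^bsub>A\<^esub> b) = (\<sim>\<^bsub>A\<^esub> a) \<sqinter>\<^bsub>A\<^esub> (\<sim>\<^bsub>A\<^esub> b)) \<and>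
     (\<forall>a\<in>carrier A. \<sim>\<^bsub>A\<^esub> (\<sim>\<^bsub>A\<^esub> a) = a)"

definition congruence_rel :: "'u hai \<Rightarrow> ('u \<times> 'u) set \<Rightarrow> bool" where
  "congruence_rel A \<theta> \<longleftrightarrow>
     equiv (carrier A) \<theta> \<and>
     (\<forall>(a, a')\<in>\<theta>. \<forall>(b, b')\<in>\<theta>.
        (a \<squnion>\<^bsub>A\<^esub> b, a' \<squnion>\<^bsub>A\<^esub> b') \<in> \<theta> \<and>
        (a \<sqinter>\<^bsub>A\<^esub> b, a' \<sqinter>\<^bsub>A\<^esub> b') \<in> \<theta> \<and>
        (a \<leadsto>\<^bsub>A\<^esub> b, a' \<leadsto>\<^bsub>A\<^esub> b') \<in> \<theta>) \<and>
     (\<forall>(a, a')\<in>\<theta>. (neg\<^bsub>A\<^esub> a, neg\<^bsub>A\<^esub> a') \<in> \<theta> \<and> (\<sim>\<^bsub>A\<^esub> a, \<sim>\<^bsub>A\<^esub> a') \<in> \<theta>)"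

text \<open>Families are nonempty, so a one-element algebra counts as subdirectly irreducible.\<close>

definition subdirectly_irreducible :: "'u hai \<Rightarrow> bool" where
  "subdirectly_irreducible A \<longleftrightarrow>
     (\<forall>F. F \<noteq> {} \<and> (\<forall>\<theta>\<in>F. congruence_rel A \<theta>) \<and> \<Inter>F = Id_on (carrier A)
        \<longrightarrow> Id_on (carrier A) \<in> F)"

datatype hterm =
    Var nat
  | Join hterm hterm
  | Meet hterm hterm
  | Imp hterm hterm
  | Neg hterm
  | Invol hterm
  | Zero
  | One

primrec vars :: "hterm \<Rightarrow> nat set" where
  "vars (Var n) = {n}"
| "vars (Join s t) = vars s \<union> vars t"
| "vars (Meet s t) = vars s \<union> vars t"
| "vars (Imp s t) = vars s \<union> vars t"
| "vars (Neg t) = vars t"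
| "vars (Invol t) = vars t"
| "vars Zero = {}"
| "vars One = {}"

primrec term_op :: "'u hai \<Rightarrow> (nat \<Rightarrow> 'u) \<Rightarrow> hterm \<Rightarrow> 'u" where
  "term_op A v (Var n) = v n"
| "term_op A v (Join s t) = term_op A v s \<squnion>\<^bsub>A\<^esub> term_op A v t"
| "term_op A v (Meet s t) = term_op A v s \<sqinter>\<^bsub>A\<^esub> term_op A v t"
| "term_op A v (Imp s t) = term_op A v s \<leadsto>\<^bsub>A\<^esub> term_op A v t"
| "term_op A v (Neg t) = neg\<^bsub>A\<^esub> (term_op A v t)"
| "term_op A v (Invol t) = \<sim>\<^bsub>A\<^esub> (term_op A v t)"
| "term_op A v Zero = \<zero>\<^bsub>A\<^esub>"
| "term_op A v One = \<one>\<^bsub>A\<^esub>"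

definition satisfies :: "'u hai \<Rightarrow> hterm \<times> hterm \<Rightarrow> bool" where
  "satisfies A e \<longleftrightarrow>
     (\<forall>v. range v \<subseteq> carrier A \<longrightarrow> term_op A v (fst e) = term_op A v (snd e))"

definition is_variety :: "'u hai set \<Rightarrow> bool" where
  "is_variety C \<longleftrightarrow> (\<exists>E. C = {A. algebra A \<and> (\<forall>e\<in>E. satisfies A e)})"

definition variety_generated :: "'u hai set \<Rightarrow> 'u hai set" where
  "variety_generated K = \<Inter>{C. is_variety C \<and> K \<subseteq> C}"

text \<open>The variables \<open>x\<close>, \<open>y\<close>, \<open>z\<close> of a ternary term are numbered 0, 1, 2.\<close>

definition ternary_term :: "hterm \<Rightarrow> bool" where
  "ternary_term t \<longleftrightarrow> vars t \<subseteq> {0, 1, 2}"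

definition ternary_op :: "'u hai \<Rightarrow> hterm \<Rightarrow> 'u \<Rightarrow> 'u \<Rightarrow> 'u \<Rightarrow> 'u" where
  "ternary_op A t a b c = term_op A (\<lambda>n. if n = 0 then a else if n = 1 then b else c) t"

definition discriminator :: "'u hai \<Rightarrow> hterm \<Rightarrow> bool" where
  "discriminator A t \<longleftrightarrow>
     ternary_term t \<and>
     (\<forall>a\<in>carrier A. \<forall>b\<in>carrier A. \<forall>c\<in>carrier A.
        ternary_op A t a b c = (if a \<noteq> b then a else c))"

definition discriminator_variety :: "'u hai set \<Rightarrow> bool" where
  "discriminator_variety V \<longleftrightarrow>
     is_variety V \<and>
     (\<exists>K'. K' \<subseteq> V \<and> V = variety_generated K' \<and> (\<exists>t. \<forall>A\<in>K'. discriminator A t))"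

text \<open>
  The intersection in \<^const>\<open>variety_generated\<close> is the class of models of the identities of \<open>K\<close>.
\<close>

lemma variety_generated_eq:
  assumes "\<And>A. A \<in> K \<Longrightarrow> algebra A"
  shows "variety_generated K =
    {B. algebra B \<and> (\<forall>e. (\<forall>A\<in>K. satisfies A e) \<longrightarrow> satisfies B e)}" (is "_ = ?M")
proof
  have "?M = {B. algebra B \<and> (\<forall>e\<in>{e. \<forall>A\<in>K. satisfies A e}. satisfies B e)}"
    by blast
  hence "is_variety ?M"
    unfolding is_variety_def by blast
  moreover have "K \<subseteq> ?M"
    using assms by blast
  ultimately show "variety_generated K \<subseteq> ?M"
    unfolding variety_generated_def by blast
  show "?M \<subseteq> variety_generated K"
    unfolding variety_generated_def is_variety_def by blast
qed

lemma is_variety_variety_generated: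
  assumes "\<And>A. A \<in> K \<Longrightarrow> algebra A"
  shows "is_variety (variety_generated K)"
proof -
  have "variety_generated K =
      {B. algebra B \<and> (\<forall>e\<in>{e. \<forall>A\<in>K. satisfies A e}. satisfies B e)}"
    using variety_generated_eq[OF assms] by auto
  thus ?thesis
    unfolding is_variety_def by blast
qed

end

theory Submission
  imports Defs
begin

text \<open>
  In a finite algebra with involution, iterating \<open>a \<mapsto> a \<sqinter> neg (\<sim> a)\<close> from \<open>a\<close> descends to some
  \<open>e\<close> with \<open>e \<sqinter> \<sim> e = \<zero>\<close>, hence also \<open>e \<squnion> \<sim> e = \<one>\<close>. Equality after meeting with such an \<open>e\<close>
  is a congruence, and the congruences of \<open>e\<close> and \<open>\<sim> e\<close> intersect in the identity. Subdirect
  irreducibility therefore leaves only \<open>e = \<one>\<close> (when \<open>a = \<one>\<close>) and \<open>e = \<zero>\<close> (otherwise). With a number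
  of iterations that suits all of \<open>K\<close>, apply this to \<open>a = (x \<leadsto> y) \<sqinter> (y \<leadsto> x)\<close>, which is \<open>\<one>\<close>
  exactly if \<open>x = y\<close>; the result \<open>e\<close> switches between \<open>z\<close> and \<open>x\<close> in \<open>(e \<sqinter> z) \<squnion> (neg e \<sqinter> x)\<close>.
\<close>

section \<open>Lattice and Heyting arithmetic\<close>

locale heyting_inv =
  fixes A :: "'u hai" (structure)
  assumes heyting_involution: "heyting_involution A"
begin

abbreviation le :: "'u \<Rightarrow> 'u \<Rightarrow> bool" (infix "\<preceq>" 50) where
  "a \<preceq> b \<equiv> below A a b"

lemma heyting_algebra: "heyting_algebra A"
  using heyting_involution unfolding heyting_involution_def by blast

lemma bounded_lattice: "bounded_lattice_alg A"
  using heyting_algebra unfolding heyting_algebra_def by blast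

lemma algebra: "algebra A"
  using bounded_lattice unfolding bounded_lattice_alg_def by blast

lemma closed [simp]:
  assumes "a \<in> carrier A" "b \<in> carrier A"
  shows "a \<squnion> b \<in> carrier A" "a \<sqinter> b \<in> carrier A" "a \<leadsto> b \<in> carrier A"
  using algebra assms unfolding algebra_def by blast+

lemma closed_unary [simp]:
  assumes "a \<in> carrier A"
  shows "neg a \<in> carrier A" "\<sim> a \<in> carrier A"
  using algebra assms unfolding algebra_def by blast+

lemma closed_bounds [simp]: "\<zero> \<in> carrier A" "\<one> \<in> carrier A"
  using algebra unfolding algebra_def by blast+

lemma commute:
  assumes "a \<in> carrier A" "b \<in> carrier A"
  shows join_commute: "a \<squnion> b = b \<squnion> a" and meet_commute: "a \<sqinter> b = b \<sqinter> a"
  using bounded_lattice assms unfolding bounded_lattice_alg_def by blast+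

lemma absorb:
  assumes "a \<in> carrier A" "b \<in> carrier A"
  shows join_meet_absorb: "a \<squnion> (a \<sqinter> b) = a" and meet_join_absorb: "a \<sqinter> (a \<squnion> b) = a"
  using bounded_lattice assms unfolding bounded_lattice_alg_def by blast+

lemma assoc:
  assumes "a \<in> carrier A" "b \<in> carrier A" "c \<in> carrier A"
  shows join_assoc: "(a \<squnion> b) \<squnion> c = a \<squnion> (b \<squnion> c)" and meet_assoc: "(a \<sqinter> b) \<sqinter> c = a \<sqinter> (b \<sqinter> c)"
  using bounded_lattice assms unfolding bounded_lattice_alg_def by blast+

lemma bounds:
  assumes "a \<in> carrier A"
  shows zero_le: "\<zero> \<preceq> a" and le_one: "a \<preceq> \<one>"
  using bounded_lattice assms unfolding bounded_lattice_alg_def by blast+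

lemma meet_idem [simp]: "a \<in> carrier A \<Longrightarrow> a \<sqinter> a = a"
  by (metis absorb closed(2))

lemma le_refl: "a \<in> carrier A \<Longrightarrow> a \<preceq> a"
  by (simp add: below_def)

lemma le_antisym: "\<lbrakk>a \<preceq> b; b \<preceq> a; a \<in> carrier A; b \<in> carrier A\<rbrakk> \<Longrightarrow> a = b"
  unfolding below_def by (metis meet_commute)

lemma le_trans:
  "\<lbrakk>a \<preceq> b; b \<preceq> c; a \<in> carrier A; b \<in> carrier A; c \<in> carrier A\<rbrakk> \<Longrightarrow> a \<preceq> c"
  unfolding below_def by (metis meet_assoc)

lemma meet_le1: "\<lbrakk>a \<in> carrier A; b \<in> carrier A\<rbrakk> \<Longrightarrow> a \<sqinter> b \<preceq> a"
  unfolding below_def by (metis meet_assoc meet_commute meet_idem)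

lemma meet_le2: "\<lbrakk>a \<in> carrier A; b \<in> carrier A\<rbrakk> \<Longrightarrow> a \<sqinter> b \<preceq> b"
  unfolding below_def by (metis meet_assoc meet_idem)

lemma meet_greatest:
  "\<lbrakk>x \<preceq> a; x \<preceq> b; x \<in> carrier A; a \<in> carrier A; b \<in> carrier A\<rbrakk> \<Longrightarrow> x \<preceq> a \<sqinter> b"
  unfolding below_def by (metis meet_assoc)

lemma le_iff_join: "\<lbrakk>a \<in> carrier A; b \<in> carrier A\<rbrakk> \<Longrightarrow> a \<preceq> b \<longleftrightarrow> a \<squnion> b = b"
  unfolding below_def by (metis absorb commute)

lemma join_ge1: "\<lbrakk>a \<in> carrier A; b \<in> carrier A\<rbrakk> \<Longrightarrow> a \<preceq> a \<squnion> b"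
  by (simp add: below_def meet_join_absorb)

lemma join_ge2: "\<lbrakk>a \<in> carrier A; b \<in> carrier A\<rbrakk> \<Longrightarrow> b \<preceq> a \<squnion> b"
  by (metis join_ge1 join_commute)

lemma join_least:
  "\<lbrakk>a \<preceq> x; b \<preceq> x; x \<in> carrier A; a \<in> carrier A; b \<in> carrier A\<rbrakk> \<Longrightarrow> a \<squnion> b \<preceq> x"
  by (simp add: le_iff_join join_assoc)

lemma bound_simps [simp]:
  assumes "a \<in> carrier A"
  shows "\<zero> \<sqinter> a = \<zero>" "a \<sqinter> \<zero> = \<zero>" "\<one> \<sqinter> a = a" "a \<sqinter> \<one> = a"
    "\<zero> \<squnion> a = a" "a \<squnion> \<zero> = a" "\<one> \<squnion> a = \<one>" "a \<squnion> \<one> = \<one>"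
proof -
  have le: "\<zero> \<preceq> a" "a \<preceq> \<one>"
    using assms by (fact zero_le, fact le_one)
  show meets: "\<zero> \<sqinter> a = \<zero>" "a \<sqinter> \<one> = a"
    using le unfolding below_def .
  show joins: "\<zero> \<squnion> a = a" "a \<squnion> \<one> = \<one>"
    using le assms by (simp_all add: le_iff_join)
  show "a \<sqinter> \<zero> = \<zero>" "\<one> \<sqinter> a = a" "a \<squnion> \<zero> = a" "\<one> \<squnion> a = \<one>"
    using meets joins assms by (simp_all add: meet_commute[of a \<zero>] meet_commute[of \<one> a]
        join_commute[of a \<zero>] join_commute[of \<one> a])
qed

text \<open>Residuation. One direction is maximality of the implication; the other combines modus
  ponens with monotonicity of meeting with \<open>a\<close>.\<close>

lemma le_imp_iff:
  assumes "a \<in> carrier A" "b \<in> carrier A" "x \<in> carrier A"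
  shows "x \<preceq> a \<leadsto> b \<longleftrightarrow> a \<sqinter> x \<preceq> b"
proof
  have 1: "a \<sqinter> (a \<leadsto> b) \<preceq> b"
    and 2: "\<And>y. y \<in> carrier A \<Longrightarrow> a \<sqinter> y \<preceq> b \<Longrightarrow> y \<preceq> a \<leadsto> b"
    using heyting_algebra assms unfolding heyting_algebra_def by blast+
  show "x \<preceq> a \<leadsto> b" if "a \<sqinter> x \<preceq> b"
    using 2 that assms by blast
  show "a \<sqinter> x \<preceq> b" if "x \<preceq> a \<leadsto> b"
  proof -
    have "a \<sqinter> x \<preceq> a \<leadsto> b"
      by (rule le_trans[OF meet_le2 that]) (simp_all add: assms)
    hence "a \<sqinter> x \<preceq> a \<sqinter> (a \<leadsto> b)"
      by (intro meet_greatest meet_le1) (simp_all add: assms)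
    thus ?thesis
      using 1 by (rule le_trans) (simp_all add: assms)
  qed
qed

lemma neg_eq: "a \<in> carrier A \<Longrightarrow> neg a = a \<leadsto> \<zero>"
  using heyting_algebra unfolding heyting_algebra_def by blast

lemma le_neg_iff:
  assumes "a \<in> carrier A" "x \<in> carrier A"
  shows "x \<preceq> neg a \<longleftrightarrow> a \<sqinter> x = \<zero>"
proof -
  have "x \<preceq> neg a \<longleftrightarrow> a \<sqinter> x \<preceq> \<zero>"
    using assms by (simp add: neg_eq le_imp_iff)
  also have "\<dots> \<longleftrightarrow> a \<sqinter> x = \<zero>"
    using assms by (auto simp: below_def)
  finally show ?thesis .
qed

text \<open>Meeting with \<open>a\<close> is left adjoint to \<open>a \<leadsto> _\<close>, so it
  preserves joins: both joinands lie below the implication, hence so does their join.\<close>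

lemma meet_join_distrib:
  assumes "a \<in> carrier A" "b \<in> carrier A" "c \<in> carrier A"
  shows "a \<sqinter> (b \<squnion> c) = (a \<sqinter> b) \<squnion> (a \<sqinter> c)"
proof (rule le_antisym)
  have "b \<squnion> c \<preceq> a \<leadsto> ((a \<sqinter> b) \<squnion> (a \<sqinter> c))"
    by (intro join_least) (simp_all add: assms le_imp_iff join_ge1 join_ge2)
  thus "a \<sqinter> (b \<squnion> c) \<preceq> (a \<sqinter> b) \<squnion> (a \<sqinter> c)"
    by (simp add: assms le_imp_iff)
  have "a \<sqinter> b \<preceq> b \<squnion> c" "a \<sqinter> c \<preceq> b \<squnion> c"
    by (rule le_trans[OF meet_le2 join_ge1] le_trans[OF meet_le2 join_ge2]; simp add: assms)+
  thus "(a \<sqinter> b) \<squnion> (a \<sqinter> c) \<preceq> a \<sqinter> (b \<squnion> c)"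
    by (intro join_least meet_greatest meet_le1) (simp_all add: assms)
qed (simp_all add: assms)

lemma join_meet_distrib_right:
  assumes "a \<in> carrier A" "b \<in> carrier A" "c \<in> carrier A"
  shows "(a \<squnion> b) \<sqinter> c = (a \<sqinter> c) \<squnion> (b \<sqinter> c)"
  using assms by (metis meet_join_distrib meet_commute closed(1))

text \<open>Idempotence of \<open>c\<close> supplies the second copy. This form shows that
  \<open>(a \<sqinter> b) \<sqinter> c\<close> depends only on \<open>a \<sqinter> c\<close> and
  \<open>b \<sqinter> c\<close>.\<close>

lemma meet_meet_distrib_right:
  assumes "a \<in> carrier A" "b \<in> carrier A" "c \<in> carrier A"
  shows "(a \<sqinter> b) \<sqinter> c = (a \<sqinter> c) \<sqinter> (b \<sqinter> c)"
proof -
  have "(a \<sqinter> c) \<sqinter> (b \<sqinter> c) = a \<sqinter> ((c \<sqinter> b) \<sqinter> c)"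
    using assms by (simp add: meet_assoc)
  also have "\<dots> = a \<sqinter> (b \<sqinter> c)"
    using assms by (simp add: meet_commute[of c b] meet_assoc)
  finally show ?thesis
    using assms by (simp add: meet_assoc)
qed

section \<open>De Morgan laws for the involution\<close>

lemma invol_invol [simp]: "a \<in> carrier A \<Longrightarrow> \<sim> (\<sim> a) = a"
  using heyting_involution unfolding heyting_involution_def by blast

lemma invol_join: "\<lbrakk>a \<in> carrier A; b \<in> carrier A\<rbrakk> \<Longrightarrow> \<sim> (a \<squnion> b) = \<sim> a \<sqinter> \<sim> b"
  using heyting_involution unfolding heyting_involution_def by blast

lemma invol_meet: "\<lbrakk>a \<in> carrier A; b \<in> carrier A\<rbrakk> \<Longrightarrow> \<sim> (a \<sqinter> b) = \<sim> a \<squnion> \<sim> b"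
  by (metis invol_invol invol_join closed(1) closed_unary(2))

lemma invol_one: "\<sim> \<one> = \<zero>"
  \<comment> \<open>At this instance the left side is \<open>\<sim> \<one>\<close>, since
    \<open>\<one>\<close> absorbs joins, and the right side is
    \<open>\<sim> \<one> \<sqinter> \<zero> = \<zero>\<close>.\<close>
  using invol_join[of \<one> "\<sim> \<zero>"] by simp

lemma invol_zero: "\<sim> \<zero> = \<one>"
  by (metis closed_bounds(2) invol_invol invol_one)

lemma neg_zero: "neg \<zero> = \<one>"
  by (rule le_antisym) (simp_all add: le_one le_neg_iff)

lemma neg_one: "neg \<one> = \<zero>"
  by (metis bound_simps(3) closed_bounds(2) closed_unary(1) le_neg_iff le_refl)

section \<open>The operator \<open>box\<close> and its iterates\<close>

definition box :: "'u \<Rightarrow> 'u" where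
  "box a = a \<sqinter> neg (\<sim> a)"

lemma box_closed [simp]: "a \<in> carrier A \<Longrightarrow> box a \<in> carrier A"
  by (simp add: box_def)

lemma box_le: "a \<in> carrier A \<Longrightarrow> box a \<preceq> a"
  by (simp add: box_def meet_le1)

lemma funpow_box_closed [simp]: "a \<in> carrier A \<Longrightarrow> (box ^^ n) a \<in> carrier A"
  by (induction n) auto

lemma funpow_box_le: "a \<in> carrier A \<Longrightarrow> (box ^^ n) a \<preceq> a"
proof (induction n)
  case (Suc n)
  show ?case
    using le_trans[OF box_le Suc.IH] Suc.prems by simp
qed (simp add: le_refl)

lemma box_one: "box \<one> = \<one>"
  by (simp add: box_def invol_one neg_zero)

text \<open>Being fixed means \<open>e \<preceq> neg (\<sim> e)\<close>, which is disjointness from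
  \<open>\<sim> e\<close> by the defining property of the pseudocomplement.\<close>

lemma box_fixpoint_iff:
  assumes "e \<in> carrier A"
  shows "box e = e \<longleftrightarrow> e \<sqinter> \<sim> e = \<zero>"
  using le_neg_iff[of "\<sim> e" e] meet_commute assms by (simp add: box_def below_def)

text \<open>Each step that moves the element strictly shrinks its down-set, so the size of the
  down-set bounds the number of steps. The induction varies \<open>a\<close> because its hypothesis
  is applied to \<open>box a\<close>.\<close>

lemma box_stabilises:
  assumes "finite (carrier A)" "a \<in> carrier A" "card {x \<in> carrier A. x \<preceq> a} \<le> n"
  shows "box ((box ^^ n) a) = (box ^^ n) a"
  using assms(2,3)
proof (induction n arbitrary: a)
  case 0
  \<comment> \<open>Impossible case: the down-set of \<open>a\<close> contains
    \<open>a\<close>.\<close>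
  then have "{x \<in> carrier A. x \<preceq> a} = {}"
    using assms(1) by simp
  thus ?case
    using le_refl 0 by blast
next
  case (Suc n)
  show ?case
  proof (cases "box a = a")
    case True
    hence "(box ^^ m) a = a" for m
      by (induction m) auto
    thus ?thesis
      using True by simp
  next
    case False
    have "{x \<in> carrier A. x \<preceq> box a} \<subset> {x \<in> carrier A. x \<preceq> a}"
    proof
      show "{x \<in> carrier A. x \<preceq> box a} \<subseteq> {x \<in> carrier A. x \<preceq> a}"
        using le_trans[OF _ box_le] Suc.prems(1) by auto
      \<comment> \<open>Equal down-sets would put \<open>a\<close> below \<open>box a\<close>,
        making \<open>a\<close> a fixed point.\<close>
      show "{x \<in> carrier A. x \<preceq> box a} \<noteq> {x \<in> carrier A. x \<preceq> a}"
        using False le_antisym[OF box_le, of a] le_refl Suc.prems(1) by auto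
    qed
    hence "card {x \<in> carrier A. x \<preceq> box a} < card {x \<in> carrier A. x \<preceq> a}"
      by (rule psubset_card_mono[rotated]) (simp add: assms(1))
    hence "box ((box ^^ n) (box a)) = (box ^^ n) (box a)"
      using Suc by simp
    thus ?thesis
      by (simp add: funpow_swap1)
  qed
qed

section \<open>Congruences given by meeting with an element\<close>

definition meet_cong :: "'u \<Rightarrow> ('u \<times> 'u) set" where
  "meet_cong e = {(a, b). a \<in> carrier A \<and> b \<in> carrier A \<and> a \<sqinter> e = b \<sqinter> e}"

text \<open>By residuation it suffices that \<open>a' \<sqinter> ?x\<close> lies below
  \<open>b'\<close>. As \<open>?x\<close> lies below \<open>e\<close>, \<open>a'\<close> may be
  replaced by \<open>a\<close> there; modus ponens then gives a bound by
  \<open>b \<sqinter> e\<close>, which is \<open>b' \<sqinter> e\<close>. The hypotheses are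
  symmetric, so equality follows.\<close>

lemma imp_meet_le:
  assumes carrier: "a \<in> carrier A" "a' \<in> carrier A" "b \<in> carrier A" "b' \<in> carrier A" "e \<in> carrier A"
    and eq: "a \<sqinter> e = a' \<sqinter> e" "b \<sqinter> e = b' \<sqinter> e"
  shows "(a \<leadsto> b) \<sqinter> e \<preceq> (a' \<leadsto> b') \<sqinter> e"
proof -
  let ?x = "(a \<leadsto> b) \<sqinter> e"
  have x_e: "?x \<preceq> e"
    by (simp add: carrier meet_le2)
  have "?x = e \<sqinter> ?x"
    using x_e carrier unfolding below_def by (metis meet_commute closed(2,3))
  hence "a' \<sqinter> ?x = a \<sqinter> ?x"
    using carrier eq by (metis meet_assoc closed(2,3))
  moreover have "a \<sqinter> ?x \<preceq> b"
    using carrier by (simp add: meet_le1 flip: le_imp_iff)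
  moreover have "a \<sqinter> ?x \<preceq> e"
    by (rule le_trans[OF meet_le2 x_e]) (simp_all add: carrier)
  ultimately have "a' \<sqinter> ?x \<preceq> b \<sqinter> e"
    using carrier by (simp add: meet_greatest)
  hence "a' \<sqinter> ?x \<preceq> b'"
    unfolding eq by (rule le_trans[OF _ meet_le1]) (simp_all add: carrier)
  thus ?thesis
    using carrier x_e by (intro meet_greatest) (simp_all add: le_imp_iff)
qed

lemma imp_meet_cong:
  assumes "a \<in> carrier A" "a' \<in> carrier A" "b \<in> carrier A" "b' \<in> carrier A" "e \<in> carrier A"
    and "a \<sqinter> e = a' \<sqinter> e" "b \<sqinter> e = b' \<sqinter> e"
  shows "(a \<leadsto> b) \<sqinter> e = (a' \<leadsto> b') \<sqinter> e"
  by (rule le_antisym; (rule imp_meet_le)?) (simp_all add: assms)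

text \<open>\<open>\<sim> c \<sqinter> e\<close> depends only on \<open>c \<sqinter> e\<close>:
  expanding \<open>\<sim> (c \<sqinter> e) \<sqinter> e\<close> by De Morgan and distributivity adds
  only the joinand \<open>\<sim> e \<sqinter> e = \<zero>\<close>.\<close>

lemma invol_meet_cong:
  assumes "a \<in> carrier A" "b \<in> carrier A" "e \<in> carrier A" "e \<sqinter> \<sim> e = \<zero>" "a \<sqinter> e = b \<sqinter> e"
  shows "\<sim> a \<sqinter> e = \<sim> b \<sqinter> e"
proof -
  have "\<sim> c \<sqinter> e = \<sim> (c \<sqinter> e) \<sqinter> e" if "c \<in> carrier A" for c
    using that assms(3,4) meet_commute[of "\<sim> e" e]
    by (simp add: invol_meet join_meet_distrib_right)
  thus ?thesis
    using assms by metis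
qed

text \<open>The relation is the Heyting congruence of the principal filter of \<open>e\<close>;
  negation is handled as implication into \<open>\<zero>\<close>. Disjointness of \<open>e\<close>
  and \<open>\<sim> e\<close> makes it respect the involution as well.\<close>

lemma congruence_meet_cong:
  assumes e: "e \<in> carrier A" and compl: "e \<sqinter> \<sim> e = \<zero>"
  shows "congruence_rel A (meet_cong e)"
proof -
  have equiv: "equiv (carrier A) (meet_cong e)"
    by (auto simp: equiv_def refl_on_def sym_def trans_def meet_cong_def)
  have meet: "(a \<sqinter> b) \<sqinter> e = (a' \<sqinter> b') \<sqinter> e"
    if "a \<in> carrier A" "a' \<in> carrier A" "b \<in> carrier A" "b' \<in> carrier A"
      "a \<sqinter> e = a' \<sqinter> e" "b \<sqinter> e = b' \<sqinter> e" for a a' b b'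
    by (simp only: meet_meet_distrib_right that e)
  have neg: "neg a \<sqinter> e = neg b \<sqinter> e"
    if "a \<in> carrier A" "b \<in> carrier A" "a \<sqinter> e = b \<sqinter> e" for a b
    unfolding neg_eq[OF that(1)] neg_eq[OF that(2)]
    by (rule imp_meet_cong) (simp_all add: that e)
  show ?thesis
    unfolding congruence_rel_def
  proof (intro conjI equiv; clarify)
    fix a a' b b'
    assume ab: "(a, a') \<in> meet_cong e" "(b, b') \<in> meet_cong e"
    hence carrier: "a \<in> carrier A" "a' \<in> carrier A" "b \<in> carrier A" "b' \<in> carrier A"
      and eq: "a \<sqinter> e = a' \<sqinter> e" "b \<sqinter> e = b' \<sqinter> e"
      by (simp_all add: meet_cong_def)
    have "(a \<squnion> b) \<sqinter> e = (a' \<squnion> b') \<sqinter> e"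
      using carrier eq e by (simp add: join_meet_distrib_right)
    thus "(a \<squnion> b, a' \<squnion> b') \<in> meet_cong e \<and> (a \<sqinter> b, a' \<sqinter> b') \<in> meet_cong e \<and>
        (a \<leadsto> b, a' \<leadsto> b') \<in> meet_cong e"
      using carrier meet[OF carrier eq] imp_meet_cong[OF carrier e eq] by (simp add: meet_cong_def)
  next
    fix a a'
    assume "(a, a') \<in> meet_cong e"
    hence carrier: "a \<in> carrier A" "a' \<in> carrier A" and eq: "a \<sqinter> e = a' \<sqinter> e"
      by (simp_all add: meet_cong_def)
    show "(neg a, neg a') \<in> meet_cong e \<and> (\<sim> a, \<sim> a') \<in> meet_cong e"
      using carrier neg[OF carrier eq] invol_meet_cong[OF carrier e compl eq]
      by (simp add: meet_cong_def)
  qed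
qed

text \<open>The relation always links \<open>e\<close> with \<open>\<one>\<close>, since both meet
  \<open>e\<close> in \<open>e\<close>.\<close>

lemma meet_cong_eq_Id_on:
  assumes "e \<in> carrier A" "meet_cong e = Id_on (carrier A)"
  shows "e = \<one>"
proof -
  have "(e, \<one>) \<in> meet_cong e"
    using assms(1) by (simp add: meet_cong_def)
  thus ?thesis
    using assms(2) by auto
qed

section \<open>Consequences of subdirect irreducibility\<close>

lemma box_fixpoint_trivial:
  assumes si: "subdirectly_irreducible A" and e: "e \<in> carrier A" and fixed: "box e = e"
  shows "e = \<zero> \<or> e = \<one>"
proof -
  have compl: "e \<sqinter> \<sim> e = \<zero>"
    using e fixed by (simp add: box_fixpoint_iff)
  hence compl': "\<sim> e \<sqinter> e = \<zero>"
    using e by (simp add: meet_commute)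
  \<comment> \<open>The involution applied to
    \<open>\<sim> e \<sqinter> e = \<zero>\<close>.\<close>
  have "e \<squnion> \<sim> e = \<one>"
    using invol_meet[of "\<sim> e" e] e compl' by (simp add: invol_zero)
  \<comment> \<open>Every element is thus recovered from its meets with \<open>e\<close> and
    \<open>\<sim> e\<close>, which is why the two congruences intersect in the identity.\<close>
  hence split: "(a \<sqinter> e) \<squnion> (a \<sqinter> \<sim> e) = a" if "a \<in> carrier A" for a
    using that e meet_join_distrib[of a e "\<sim> e"] by simp
  let ?F = "{meet_cong e, meet_cong (\<sim> e)}"
  have "\<Inter>?F = Id_on (carrier A)"
  proof (intro equalityI subrelI)
    fix a b
    assume "(a, b) \<in> \<Inter>?F"
    hence carrier: "a \<in> carrier A" "b \<in> carrier A"
      and eq: "a \<sqinter> e = b \<sqinter> e" "a \<sqinter> \<sim> e = b \<sqinter> \<sim> e"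
      unfolding meet_cong_def by blast+
    have "a = (a \<sqinter> e) \<squnion> (a \<sqinter> \<sim> e)"
      by (rule split[OF carrier(1), symmetric])
    also have "\<dots> = b"
      unfolding eq by (rule split[OF carrier(2)])
    finally show "(a, b) \<in> Id_on (carrier A)"
      using carrier by (simp only: Id_on_iff)
  next
    fix a b
    assume "(a, b) \<in> Id_on (carrier A)"
    thus "(a, b) \<in> \<Inter>?F"
      unfolding meet_cong_def by blast
  qed
  \<comment> \<open>Disjointness is symmetric under exchanging \<open>e\<close> and
    \<open>\<sim> e\<close>, because \<open>\<sim> (\<sim> e) = e\<close>.\<close>
  moreover have "\<forall>\<theta>\<in>?F. congruence_rel A \<theta>"
    using e compl compl' by (simp add: congruence_meet_cong)
  ultimately have "Id_on (carrier A) \<in> ?F"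
    by (intro si[unfolded subdirectly_irreducible_def, rule_format, of ?F]) simp
  hence "meet_cong e = Id_on (carrier A) \<or> meet_cong (\<sim> e) = Id_on (carrier A)"
    by blast
  hence "e = \<one> \<or> \<sim> e = \<one>"
    using meet_cong_eq_Id_on[OF e] meet_cong_eq_Id_on[OF closed_unary(2)[OF e]] by argo
  moreover have "e = \<zero>" if "\<sim> e = \<one>"
    using compl e that by simp
  ultimately show ?thesis
    by blast
qed

lemma funpow_box_eq:
  assumes "subdirectly_irreducible A" "finite (carrier A)" "card (carrier A) \<le> n" "a \<in> carrier A"
  shows "(box ^^ n) a = (if a = \<one> then \<one> else \<zero>)"
proof (cases "a = \<one>")
  case True
  have "(box ^^ n) \<one> = \<one>"
    by (induction n) (auto simp: box_one)
  thus ?thesis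
    using True by simp
next
  case False
  \<comment> \<open>The down-set lies in the carrier, so \<open>n\<close> steps reach a fixed point,
    whatever \<open>a\<close> is.\<close>
  have "card {x \<in> carrier A. x \<preceq> a} \<le> n"
    using card_mono[of "carrier A" "{x \<in> carrier A. x \<preceq> a}"] assms(2,3) by auto
  hence "(box ^^ n) a = \<zero> \<or> (box ^^ n) a = \<one>"
    using assms by (intro box_fixpoint_trivial box_stabilises) auto
  \<comment> \<open>The iterate lies below \<open>a\<close>, so the value \<open>\<one>\<close>
    would force \<open>a = \<one>\<close>.\<close>
  moreover have "(box ^^ n) a \<noteq> \<one>"
    using funpow_box_le[OF assms(4), of n] False assms(4) by (auto simp: below_def)
  ultimately show ?thesis
    using False by simp
qed

text \<open>By residuation, \<open>\<one> \<preceq> a \<leadsto> b\<close> says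
  \<open>a \<preceq> b\<close>; antisymmetry does the rest.\<close>

lemma imp_meet_imp_eq_one_iff:
  assumes "a \<in> carrier A" "b \<in> carrier A"
  shows "(a \<leadsto> b) \<sqinter> (b \<leadsto> a) = \<one> \<longleftrightarrow> a = b"
proof
  assume "(a \<leadsto> b) \<sqinter> (b \<leadsto> a) = \<one>"
  hence "\<one> \<preceq> a \<leadsto> b" "\<one> \<preceq> b \<leadsto> a"
    using meet_le1[of "a \<leadsto> b" "b \<leadsto> a"] meet_le2[of "a \<leadsto> b" "b \<leadsto> a"] assms by auto
  thus "a = b"
    using assms le_antisym by (simp add: le_imp_iff)
next
  assume "a = b"
  moreover have "\<one> \<preceq> b \<leadsto> b"
    using assms by (simp add: le_imp_iff le_refl)
  ultimately show "(a \<leadsto> b) \<sqinter> (b \<leadsto> a) = \<one>"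
    using assms by (simp add: below_def)
qed

end

section \<open>The discriminator term\<close>

definition box_term :: "hterm \<Rightarrow> hterm" where
  "box_term t = Meet t (Neg (Invol t))"

text \<open>An equality test: in a subdirectly irreducible algebra with at most \<open>n\<close>
  elements its value is \<open>\<one>\<close> if variables 0 and 1 agree and \<open>\<zero>\<close>
  otherwise.\<close>

definition eq_term :: "nat \<Rightarrow> hterm" where
  "eq_term n = (box_term ^^ n) (Meet (Imp (Var 0) (Var 1)) (Imp (Var 1) (Var 0)))"

definition disc_term :: "nat \<Rightarrow> hterm" where
  "disc_term n = Join (Meet (eq_term n) (Var 2)) (Meet (Neg (eq_term n)) (Var 0))"

lemma vars_funpow_box_term: "vars ((box_term ^^ n) t) = vars t"
  by (induction n) (auto simp: box_term_def)

lemma ternary_disc_term: "ternary_term (disc_term n)"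
  by (simp add: ternary_term_def disc_term_def eq_term_def vars_funpow_box_term)

lemma (in heyting_inv) term_op_funpow_box_term:
  "term_op A v ((box_term ^^ n) t) = (box ^^ n) (term_op A v t)"
  by (induction n) (simp_all add: box_term_def box_def)

text \<open>When the equality test gives \<open>\<one>\<close>, the term becomes
  \<open>c \<squnion> (\<zero> \<sqinter> a) = c\<close>; when it gives \<open>\<zero>\<close>, it
  becomes \<open>\<zero> \<squnion> (\<one> \<sqinter> a) = a\<close>.\<close>

lemma (in heyting_inv) discriminator_disc_term:
  assumes "subdirectly_irreducible A" "finite (carrier A)" "card (carrier A) \<le> n"
  shows "discriminator A (disc_term n)"
proof -
  have "ternary_op A (disc_term n) a b c = (if a \<noteq> b then a else c)"
    if "a \<in> carrier A" "b \<in> carrier A" "c \<in> carrier A" for a b c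
    using that funpow_box_eq[OF assms, of "(a \<leadsto> b) \<sqinter> (b \<leadsto> a)"]
    by (simp add: ternary_op_def disc_term_def eq_term_def term_op_funpow_box_term
        imp_meet_imp_eq_one_iff neg_zero neg_one)
  thus ?thesis
    by (simp add: discriminator_def ternary_disc_term)
qed

theorem theorem4p3:
  fixes K V :: "'u hai set"
  assumes "finite K"
    and "\<And>A. A \<in> K \<Longrightarrow> heyting_involution A"
    and "\<And>A. A \<in> K \<Longrightarrow> finite (carrier A)"
    and "\<And>A. A \<in> K \<Longrightarrow> subdirectly_irreducible A"
    and "V = variety_generated K"
  shows "discriminator_variety V"
proof -
  \<comment> \<open>A common bound on the cardinalities, so that one term serves all of
    \<open>K\<close>; finiteness of \<open>K\<close> makes each summand at most the sum.\<close>
  define n where "n = (\<Sum>A\<in>K. card (carrier A))"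
  have inv: "heyting_inv A" if "A \<in> K" for A
    using assms(2)[OF that] by unfold_locales
  have "card (carrier A) \<le> n" if "A \<in> K" for A
    unfolding n_def using assms(1) that by (intro member_le_sum[where f = "\<lambda>A. card (carrier A)"]) auto
  hence "discriminator A (disc_term n)" if "A \<in> K" for A
    using heyting_inv.discriminator_disc_term[OF inv] assms(3,4) that by blast
  moreover have "is_variety V"
    unfolding assms(5) by (rule is_variety_variety_generated) (rule heyting_inv.algebra[OF inv])
  moreover have "K \<subseteq> V"
    unfolding assms(5) variety_generated_def by blast
  \<comment> \<open>The generating class with a common discriminator is \<open>K\<close>
    itself.\<close>
  ultimately show ?thesis
    unfolding discriminator_variety_def using assms(5) by blast
qed

end
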